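(* Let $(X,\mathcal{T})$ be an algebraic $E$-test space and let $f,g\in\mathcal{E}(X,\mathcal{T})$. Then the meet $\pi(f)\land\pi(g)$ exists in $\Pi(X)$ if and only if there exist $f_1,f_2,f_3,f_4\in\mathcal{T}$ such that $f,g$ satisfy the M-condition for $(f_1,f_2,f_3,f_4)$. Moreover, if $f,g$ satisfy the M-condition for $(f_1,f_2,f_3,f_4)\in lb(f,g)$, then $$\pi(f)\land\pi(g)=\pi(h),$$ where $h(x)=\min\bigl(f(x)-f_2(x)+f_1(x),\; g(x)-f_4(x)+f_3(x)\bigr)$ for every $x\in X$.
   Context: Let $X$ be a nonempty set, $\mathbb{N}_0=\{0,1,2,\dots\}$. Functions $X\to\mathbb{Z}$ are compared, added, subtracted, and have minima taken pointwise (expressions such as $f-f_2+f_1$ are integer-valued functions on $X$, possibly with negative values); $f\le g$ means $f(x)\le g(x)$ for all $x\in X$; $f_0$ is the zero function. A pair $(X,\mathcal{T})$ with $\mathcal{T}\subseteq\mathbb{N}_0^X$ is an $E$-test space if (1) for every $x\in X$ there is $t\in\mathcal{T}$ with $t(x)\neq 0$, and (2) $s,t\in\mathcal{T}$ and $s\le t$ imply $s=t$. Put $\mathcal{E}(X,\mathcal{T})=\{f\in\mathbb{N}_0^X : f\le t\text{ for some }t\in\mathcal{T}\}$. For $f,g,h\in\mathcal{E}(X,\mathcal{T})$: $f\perp g$ means $f+g\in\mathcal{E}(X,\mathcal{T})$; $f\approx_h g$ means $f+h\in\mathcal{T}$ and $g+h\in\mathcal{T}$; $f\approx g$ means $f\approx_h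 g$ for some $h\in\mathcal{E}(X,\mathcal{T})$. The $E$-test space is algebraic if for all $f,g,h\in\mathcal{E}(X,\mathcal{T})$, $f\approx g$ and $h\perp f$ imply $h\perp g$. For an algebraic $E$-test space, $\pi(f)=\{g\in\mathcal{E}(X,\mathcal{T}): g\approx f\}$ for $f\in\mathcal{E}(X,\mathcal{T})$, and $\Pi(X)=\{\pi(f): f\in\mathcal{E}(X,\mathcal{T})\}$, which is an effect algebra (a known result of Gudder) with $0=\pi(f_0)$, $1=\pi(t)$ for any $t\in\mathcal{T}$, and partial operation $\pi(f)\oplus\pi(g)=\pi(f+g)$, defined when $f\perp g$. The partial order on $\Pi(X)$ is: $p\le q$ iff there is $r\in\Pi(X)$ such that $p\oplus r$ is defined and $p\oplus r=q$. Meets are taken in this partial order. For $f,g\in\mathcal{E}(X,\mathcal{T})$ define $$lb(f,g)=\{(f_1,f_2,f_3,f_4)\in\mathcal{T}^4 : f\le f_2,\ g\le f_4,\ f-f_2+f_1\ge f_0,\ g-f_4+f_3\ge f_0\}.$$ For every $(f_1,f_2,f_3,f_4)\in lb(f,g)$ the function $\min(f-f_2+f_1,\,g-f_4+f_3)$ belongs to $\mathcal{E}(X,\mathcal{T})$. $f,g$ satisfy the M-condition for $(f_1,f_2,f_3,f_4)\in\mathcal{T}^4$ if and only if: (M1) $(f_1,f_2,f_3,f_4)\in lb(f,g)$, i.e. $f\le f_2$, $g\le f_4$, $f-f_2+f_1\ge f_0$, $g-f_4+f_3\ge f_0$; and (M2) for every $(g_1,g_2,g_3,g_4)\in lb(f,g)$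 one has $$\pi(\min(f-f_2+f_1,\,g-f_4+f_3))\ge\pi(\min(f-g_2+g_1,\,g-g_4+g_3)).$$ *)

theory Defs
  imports "HOL-Library.Function_Algebras" "HOL-Algebra.Lattice"
begin

text \<open>
  The nonempty set \<open>X\<close> is the universe of the type variable \<open>'a\<close>. Functions from \<open>X\<close> to the
  natural numbers or integers carry the pointwise order and the pointwise operations
  of \<^theory>\<open>HOL-Library.Function_Algebras\<close>.
\<close>

definition E_test_space :: "('a \<Rightarrow> nat) set \<Rightarrow> bool" where
  "E_test_space T \<longleftrightarrow>
    (\<forall>x. \<exists>t\<in>T. t x \<noteq> 0) \<and> (\<forall>s\<in>T. \<forall>t\<in>T. s \<le> t \<longrightarrow> s = t)"

definition events :: "('a \<Rightarrow> nat) set \<Rightarrow> ('a \<Rightarrow> nat) set" where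
  "events T = {f. \<exists>t\<in>T. f \<le> t}"

definition perp :: "('a \<Rightarrow> nat) set \<Rightarrow> ('a \<Rightarrow> nat) \<Rightarrow> ('a \<Rightarrow> nat) \<Rightarrow> bool" where
  "perp T f g \<longleftrightarrow> f + g \<in> events T"

definition perspective_via ::
  "('a \<Rightarrow> nat) set \<Rightarrow> ('a \<Rightarrow> nat) \<Rightarrow> ('a \<Rightarrow> nat) \<Rightarrow> ('a \<Rightarrow> nat) \<Rightarrow> bool" where
  "perspective_via T h f g \<longleftrightarrow> f + h \<in> T \<and> g + h \<in> T"

definition perspective :: "('a \<Rightarrow> nat) set \<Rightarrow> ('a \<Rightarrow> nat) \<Rightarrow> ('a \<Rightarrow> nat) \<Rightarrow> bool" where
  "perspective T f g \<longleftrightarrow> (\<exists>h\<in>events T. perspective_via T h f g)"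

definition algebraic_E_test_space :: "('a \<Rightarrow> nat) set \<Rightarrow> bool" where
  "algebraic_E_test_space T \<longleftrightarrow> E_test_space T \<and>
    (\<forall>f\<in>events T. \<forall>g\<in>events T. \<forall>h\<in>events T.
      perspective T f g \<and> perp T h f \<longrightarrow> perp T h g)"

definition pi_class :: "('a \<Rightarrow> nat) set \<Rightarrow> ('a \<Rightarrow> nat) \<Rightarrow> ('a \<Rightarrow> nat) set" where
  "pi_class T f = {g \<in> events T. perspective T g f}"

definition Pi_classes :: "('a \<Rightarrow> nat) set \<Rightarrow> ('a \<Rightarrow> nat) set set" where
  "Pi_classes T = pi_class T ` events T"

text \<open>
  The partial operation on classes is given by its graph: \<open>oplus_eq T p q s\<close> says that
  \<open>p \<oplus> q\<close> is defined and equal to \<open>s\<close>. That this graph is single-valued, and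
  that definedness does not depend on the representatives, is shown below.
\<close>

definition oplus_eq ::
  "('a \<Rightarrow> nat) set \<Rightarrow> ('a \<Rightarrow> nat) set \<Rightarrow> ('a \<Rightarrow> nat) set \<Rightarrow> ('a \<Rightarrow> nat) set \<Rightarrow> bool" where
  "oplus_eq T p q s \<longleftrightarrow> (\<exists>f\<in>events T. \<exists>g\<in>events T.
    p = pi_class T f \<and> q = pi_class T g \<and> perp T f g \<and> s = pi_class T (f + g))"

definition Pi_order :: "('a \<Rightarrow> nat) set \<Rightarrow> ('a \<Rightarrow> nat) set gorder" where
  "Pi_order T = \<lparr>carrier = Pi_classes T, eq = (=),
     le = (\<lambda>p q. \<exists>r\<in>Pi_classes T. oplus_eq T p r q)\<rparr>"

definition shift :: "('a \<Rightarrow> nat) \<Rightarrow> ('a \<Rightarrow> nat) \<Rightarrow> ('a \<Rightarrow> nat) \<Rightarrow> 'a \<Rightarrow> int" where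
  "shift f s t = (\<lambda>x. int (f x) - int (s x) + int (t x))"

definition lb ::
  "('a \<Rightarrow> nat) set \<Rightarrow> ('a \<Rightarrow> nat) \<Rightarrow> ('a \<Rightarrow> nat) \<Rightarrow>
    (('a \<Rightarrow> nat) \<times> ('a \<Rightarrow> nat) \<times> ('a \<Rightarrow> nat) \<times> ('a \<Rightarrow> nat)) set" where
  "lb T f g = {(f1, f2, f3, f4). f1 \<in> T \<and> f2 \<in> T \<and> f3 \<in> T \<and> f4 \<in> T \<and>
     f \<le> f2 \<and> g \<le> f4 \<and> shift f f2 f1 \<ge> 0 \<and> shift g f4 f3 \<ge> 0}"

text \<open>
  The minimum is converted to a \<open>nat\<close>-valued function; on \<^const>\<open>lb\<close> the conversion
  is exact (lemma \<open>lb_min_int\<close>).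
\<close>

definition lb_min ::
  "('a \<Rightarrow> nat) \<Rightarrow> ('a \<Rightarrow> nat) \<Rightarrow>
    ('a \<Rightarrow> nat) \<times> ('a \<Rightarrow> nat) \<times> ('a \<Rightarrow> nat) \<times> ('a \<Rightarrow> nat) \<Rightarrow> 'a \<Rightarrow> nat" where
  "lb_min f g = (\<lambda>(f1, f2, f3, f4) x. nat (min (shift f f2 f1 x) (shift g f4 f3 x)))"

definition M_condition ::
  "('a \<Rightarrow> nat) set \<Rightarrow> ('a \<Rightarrow> nat) \<Rightarrow> ('a \<Rightarrow> nat) \<Rightarrow>
    ('a \<Rightarrow> nat) \<times> ('a \<Rightarrow> nat) \<times> ('a \<Rightarrow> nat) \<times> ('a \<Rightarrow> nat) \<Rightarrow> bool" where
  "M_condition T f g F \<longleftrightarrow> F \<in> lb T f g \<and>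
    (\<forall>G \<in> lb T f g.
      pi_class T (lb_min f g G) \<sqsubseteq>\<^bsub>Pi_order T\<^esub> pi_class T (lb_min f g F))"

lemma lb_min_int:
  assumes "(f1, f2, f3, f4) \<in> lb T f g"
  shows "int (lb_min f g (f1, f2, f3, f4) x) =
    min (int (f x) - int (f2 x) + int (f1 x)) (int (g x) - int (f4 x) + int (f3 x))"
  using assms by (auto simp: lb_def lb_min_def shift_def le_fun_def)

lemma lb_min_events:
  assumes "F \<in> lb T f g"
  shows "lb_min f g F \<in> events T"
proof -
  obtain f1 f2 f3 f4 where F: "F = (f1, f2, f3, f4)" by (cases F)
  have "f1 \<in> T" "f \<le> f2" using assms by (auto simp: F lb_def)
  moreover have "lb_min f g F x \<le> f1 x" for x
  proof -
    have "f x \<le> f2 x" using \<open>f \<le> f2\<close> by (simp add: le_fun_def)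
    then show ?thesis unfolding F lb_min_def shift_def by simp
  qed
  ultimately show ?thesis by (auto simp: events_def le_fun_def)
qed

lemma events_down: "f \<in> events T \<Longrightarrow> g \<le> f \<Longrightarrow> g \<in> events T"
  by (auto simp: events_def intro: order_trans)

lemma events_addD:
  assumes "f + g \<in> events T"
  shows "f \<in> events T" "g \<in> events T"
  by (rule events_down[OF assms], simp add: le_fun_def)+

lemma tests_events: "t \<in> T \<Longrightarrow> t \<in> events T"
  by (auto simp: events_def)

lemma events_complement:
  assumes "f \<in> events T"
  obtains h where "f + h \<in> T"
proof -
  obtain t where t: "t \<in> T" "f \<le> t" using assms by (auto simp: events_def)
  have "f + (\<lambda>x. t x - f x) = t" using t(2) by (auto simp: le_fun_def fun_eq_iff)
  with t(1) that show ?thesis by metis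
qed

lemma perspectiveI: "f + h \<in> T \<Longrightarrow> g + h \<in> T \<Longrightarrow> perspective T f g"
  unfolding perspective_def perspective_via_def by (meson events_addD(2) tests_events)

lemma perspective_sym: "perspective T f g \<Longrightarrow> perspective T g f"
  by (auto simp: perspective_def perspective_via_def)

lemma perspective_refl: "f \<in> events T \<Longrightarrow> perspective T f f"
  by (meson events_complement perspectiveI)

lemma perspective_events:
  assumes "perspective T f g"
  shows "f \<in> events T" "g \<in> events T"
  using assms unfolding perspective_def perspective_via_def
  by (meson events_addD(1) tests_events)+

context
  fixes T :: "('a \<Rightarrow> nat) set"
  assumes alg: "algebraic_E_test_space T"
begin

lemma perp_perspective: "perspective T f g \<Longrightarrow> f + h \<in> events T \<Longrightarrow> g + h \<in> events T"
  using alg unfolding algebraic_E_test_space_def perp_def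
  by (metis add.commute events_addD(2) perspective_events)

lemma tests_eq: "s \<in> T \<Longrightarrow> t \<in> T \<Longrightarrow> s \<le> t \<Longrightarrow> s = t"
  using alg unfolding algebraic_E_test_space_def E_test_space_def by blast

lemma test_perspective:
  assumes p: "perspective T f g" and t: "f + h \<in> T"
  shows "g + h \<in> T"
proof -
  have "g + h \<in> events T" using perp_perspective[OF p tests_events[OF t]] .
  then obtain u where u: "g + h + u \<in> T" by (rule events_complement)
  then have "f + (h + u) \<in> events T"
    using perp_perspective[OF perspective_sym[OF p], of "h + u"]
    by (simp add: add.assoc tests_events)
  then obtain t' where t': "t' \<in> T" "f + (h + u) \<le> t'" by (auto simp: events_def)
  have "f + h \<le> t'" using t'(2) by (auto simp: le_fun_def intro: add_leD1 simp: add.assoc[symmetric])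
  with t t'(1) have "f + h = t'" by (rule tests_eq)
  with t'(2) have "f + (h + u) \<le> f + h" by simp
  then have "u = 0" by (simp add: le_fun_def fun_eq_iff)
  with u show ?thesis by simp
qed

lemma perspective_trans:
  assumes "perspective T f g" "perspective T g h"
  shows "perspective T f h"
proof -
  obtain k where "f + k \<in> T" "g + k \<in> T"
    using assms(1) by (auto simp: perspective_def perspective_via_def)
  then show ?thesis using test_perspective[OF assms(2)] perspectiveI by blast
qed

lemma pi_class_eq_iff:
  assumes "f \<in> events T" "g \<in> events T"
  shows "pi_class T f = pi_class T g \<longleftrightarrow> perspective T f g"
proof
  assume "pi_class T f = pi_class T g"
  then show "perspective T f g" using perspective_refl[OF assms(1)] assms(1)
    by (auto simp: pi_class_def)
next
  assume "perspective T f g"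
  then show "pi_class T f = pi_class T g"
    by (auto simp: pi_class_def intro: perspective_trans perspective_sym)
qed

lemma perspective_add:
  assumes "perspective T f f'" "perspective T g g'" "f + g \<in> events T"
  shows "perspective T (f + g) (f' + g')"
proof -
  obtain k where k: "f + g + k \<in> T" using assms(3) by (rule events_complement)
  then have "f' + (g + k) \<in> T"
    using test_perspective[OF assms(1), of "g + k"] by (simp add: add.assoc)
  then have "g' + (f' + k) \<in> T"
    using test_perspective[OF assms(2), of "f' + k"] by (simp add: ac_simps)
  with k show ?thesis by (intro perspectiveI[of _ k]) (simp_all add: ac_simps)
qed

lemma oplus_eq_iff:
  assumes "f \<in> events T" "g \<in> events T"
  shows "oplus_eq T (pi_class T f) (pi_class T g) s \<longleftrightarrow> perp T f g \<and> s = pi_class T (f + g)"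
proof
  assume "oplus_eq T (pi_class T f) (pi_class T g) s"
  then obtain f' g' where *: "perspective T f' f" "perspective T g' g"
    "f' + g' \<in> events T" "s = pi_class T (f' + g')"
    using assms by (auto simp: oplus_eq_def perp_def pi_class_eq_iff intro: perspective_sym)
  have p: "perspective T (f' + g') (f + g)" by (rule perspective_add) fact+
  moreover have "f + g \<in> events T" using p by (rule perspective_events)
  ultimately show "perp T f g \<and> s = pi_class T (f + g)"
    using * by (simp add: perp_def pi_class_eq_iff)
qed (use assms in \<open>auto simp: oplus_eq_def\<close>)

lemma oplus_eq_unique: "oplus_eq T p q s \<Longrightarrow> oplus_eq T p q s' \<Longrightarrow> s = s'"
  using oplus_eq_iff unfolding oplus_eq_def[of T p q s] by blast

lemma Pi_order_le_iff:
  assumes "f \<in> events T" "g \<in> events T"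
  shows "pi_class T f \<sqsubseteq>\<^bsub>Pi_order T\<^esub> pi_class T g \<longleftrightarrow> (\<exists>r. perspective T (f + r) g)"
proof
  assume "pi_class T f \<sqsubseteq>\<^bsub>Pi_order T\<^esub> pi_class T g"
  then obtain r where "r \<in> events T" "perp T f r" "pi_class T g = pi_class T (f + r)"
    using assms(1) by (auto simp: Pi_order_def Pi_classes_def oplus_eq_iff)
  then show "\<exists>r. perspective T (f + r) g"
    using assms(2) by (auto simp: perp_def pi_class_eq_iff intro: perspective_sym)
next
  assume "\<exists>r. perspective T (f + r) g"
  then obtain r where r: "perspective T (f + r) g" ..
  then have e: "f + r \<in> events T" by (rule perspective_events)
  then have "r \<in> events T" by (rule events_addD)
  moreover have "pi_class T (f + r) = pi_class T g" using e assms(2) r by (simp add: pi_class_eq_iff)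
  ultimately show "pi_class T f \<sqsubseteq>\<^bsub>Pi_order T\<^esub> pi_class T g"
    using e assms(1) by (auto simp: Pi_order_def Pi_classes_def oplus_eq_iff perp_def)
qed

lemma Pi_order_partial_order: "partial_order (Pi_order T)"
proof (unfold_locales, goal_cases)
  case (4 p)
  then obtain f where f: "f \<in> events T" "p = pi_class T f"
    by (auto simp: Pi_order_def Pi_classes_def)
  have "perspective T (f + 0) f" using f(1) by (simp add: perspective_refl)
  with f show ?case using Pi_order_le_iff by blast
next
  case (5 p q)
  then obtain f g where fg: "f \<in> events T" "p = pi_class T f" "g \<in> events T" "q = pi_class T g"
    by (auto simp: Pi_order_def Pi_classes_def)
  with 5 obtain r s where r: "perspective T (f + r) g" and s: "perspective T (g + s) f"
    by (auto simp: Pi_order_le_iff)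
  obtain c where c: "f + c \<in> T" using fg(1) by (rule events_complement)
  have "g + (s + c) \<in> T"
    using test_perspective[OF perspective_sym[OF s] c] by (simp add: add.assoc)
  then have t: "f + r + (s + c) \<in> T" by (rule test_perspective[OF perspective_sym[OF r]])
  have "f + c = f + r + (s + c)"
    by (rule tests_eq[OF c t]) (simp add: le_fun_def)
  then have "r = 0" by (auto simp: fun_eq_iff)
  with r fg show ?case by (simp add: Pi_order_def pi_class_eq_iff)
next
  case (6 p q w)
  then obtain f g h where fgh: "f \<in> events T" "p = pi_class T f" "g \<in> events T" "q = pi_class T g"
    "h \<in> events T" "w = pi_class T h"
    by (auto simp: Pi_order_def Pi_classes_def)
  with 6 obtain r s where r: "perspective T (f + r) g" and s: "perspective T (g + s) h"
    by (auto simp: Pi_order_le_iff)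
  have e: "g + s \<in> events T" using s by (rule perspective_events)
  then have "s \<in> events T" by (rule events_addD)
  then have "perspective T (g + s) (f + r + s)"
    by (intro perspective_add perspective_sym[OF r] perspective_refl e)
  then have "perspective T (f + (r + s)) h"
    using s by (metis perspective_sym perspective_trans add.assoc)
  with fgh show ?case by (auto simp: Pi_order_le_iff)
qed (auto simp: Pi_order_def)

end

end

theory Submission
  imports Defs
begin

text \<open>
  If \<open>c\<close> completes \<open>f\<close> to the test \<open>f\<^sub>2 = f + c\<close>, and \<open>f\<^sub>1\<close> is any test above \<open>c\<close>, then
  \<open>f - f\<^sub>2 + f\<^sub>1 = f\<^sub>1 - c\<close> has the complement \<open>c\<close> in common with \<open>f\<close>. The shifts \<open>f - f\<^sub>2 + f\<^sub>1\<close> that are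
  nonnegative are therefore precisely the events perspective to \<open>f\<close>, that is, the representatives
  of \<open>\<pi>(f)\<close>. Consequently, the elements of \<open>lb(f, g)\<close> are a way of choosing a representative \<open>f'\<close> of
  \<open>\<pi>(f)\<close> and a representative \<open>g'\<close> of \<open>\<pi>(g)\<close>, and the function attached to such a choice is
  \<open>min(f', g')\<close>.

  A class \<open>\<pi>(k)\<close> lies below \<open>\<pi>(f)\<close> iff some representative of \<open>\<pi>(f)\<close> lies above \<open>k\<close> pointwise. Hence every
  \<open>\<pi>(min(f', g'))\<close> is a lower bound of \<open>\<pi>(f)\<close> and \<open>\<pi>(g)\<close> (\<open>lb_min_lower\<close>), and every lower bound is
  dominated by one of this form (\<open>lower_bound_below_lb_min\<close>): the classes \<open>\<pi>(min(f', g'))\<close> are cofinal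
  among the lower bounds. A cofinal family contains a greatest member iff the whole set of lower
  bounds does, and the two greatest elements then coincide; (M2) says that the given choice yields a
  greatest member of the family.
\<close>

text \<open>A common complement \<open>c\<close> of \<open>k\<close> and \<open>f\<close> gives the tests \<open>s = f + c\<close> and \<open>t = k + c\<close>; conversely,
  \<open>c\<close> is recovered as \<open>s - f\<close>.\<close>

lemma perspective_iff_shift:
  "perspective T k f \<longleftrightarrow>
    (\<exists>s\<in>T. \<exists>t\<in>T. f \<le> s \<and> (\<forall>x. int (k x) = shift f s t x))"
proof
  assume "perspective T k f"
  then obtain c where c: "k + c \<in> T" "f + c \<in> T"
    by (auto simp: perspective_def perspective_via_def)
  have "f \<le> f + c" "\<forall>x. int (k x) = shift f (f + c) (k + c) x"
    by (auto simp: le_fun_def shift_def)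
  with c show "\<exists>s\<in>T. \<exists>t\<in>T. f \<le> s \<and> (\<forall>x. int (k x) = shift f s t x)"
    by blast
next
  assume "\<exists>s\<in>T. \<exists>t\<in>T. f \<le> s \<and> (\<forall>x. int (k x) = shift f s t x)"
  then obtain s t where st: "s \<in> T" "t \<in> T" "f \<le> s" and k: "\<And>x. int (k x) = shift f s t x"
    by blast
  define c where "c = (\<lambda>x. s x - f x)"
  have s: "f + c = s"
    using st(3) by (auto simp: c_def le_fun_def fun_eq_iff)
  have "k + c = t"
  proof
    fix x
    have "int (k x) = int (f x) - int (s x) + int (t x)" "f x \<le> s x"
      using k[of x] st(3) by (simp_all add: shift_def le_fun_def)
    then show "(k + c) x = t x" by (simp add: c_def)
  qed
  with s st show "perspective T k f"
    by (intro perspectiveI[of k c]) simp_all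
qed

text \<open>The next two lemmas eliminate the integer subtraction from \<^const>\<open>lb\<close> and \<^const>\<open>lb_min\<close>, so that the
  order on classes can be treated by pointwise comparison of events.\<close>

lemma lb_imp_min_of_representatives:
  assumes "F \<in> lb T f g"
  obtains f' g' where "perspective T f' f" "perspective T g' g" "lb_min f g F = inf f' g'"
proof -
  obtain f1 f2 f3 f4 where F: "F = (f1, f2, f3, f4)" by (cases F)
  define f' g' where "f' = (\<lambda>x. nat (shift f f2 f1 x))" and "g' = (\<lambda>x. nat (shift g f4 f3 x))"
  have "\<forall>x. int (f' x) = shift f f2 f1 x" "\<forall>x. int (g' x) = shift g f4 f3 x"
    using assms by (auto simp: F lb_def f'_def g'_def le_fun_def)
  then have "perspective T f' f" "perspective T g' g"
    using assms by (auto simp: perspective_iff_shift F lb_def)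
  moreover have "lb_min f g F = inf f' g'"
    by (simp add: F lb_min_def f'_def g'_def fun_eq_iff inf_min min_def)
  ultimately show thesis by (rule that)
qed

lemma min_of_representatives_in_lb:
  assumes "perspective T f' f" "perspective T g' g"
  obtains F where "F \<in> lb T f g" "lb_min f g F = inf f' g'"
proof -
  obtain f1 f2 f3 f4 where
    "f1 \<in> T" "f2 \<in> T" "f \<le> f2" and f': "\<And>x. int (f' x) = shift f f2 f1 x" and
    "f3 \<in> T" "f4 \<in> T" "g \<le> f4" and g': "\<And>x. int (g' x) = shift g f4 f3 x"
    using assms by (auto simp: perspective_iff_shift)
  moreover have "shift f f2 f1 \<ge> 0" "shift g f4 f3 \<ge> 0"
    by (simp_all add: le_fun_def flip: f' g')
  ultimately have "(f1, f2, f3, f4) \<in> lb T f g"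
    by (simp add: lb_def)
  moreover have "lb_min f g (f1, f2, f3, f4) = inf f' g'"
    by (simp add: lb_min_def fun_eq_iff inf_min min_def flip: f' g')
  ultimately show thesis by (rule that)
qed

context
  fixes T :: "('a \<Rightarrow> nat) set"
  assumes alg: "algebraic_E_test_space T"
begin

lemma Pi_order_le_iff_representative:
  assumes "k \<in> events T" "f \<in> events T"
  shows "pi_class T k \<sqsubseteq>\<^bsub>Pi_order T\<^esub> pi_class T f \<longleftrightarrow> (\<exists>f'. perspective T f' f \<and> k \<le> f')"
proof -
  have "f' = k + (\<lambda>x. f' x - k x)" if "k \<le> f'" for f'
    using that by (auto simp: le_fun_def fun_eq_iff)
  moreover have "k \<le> k + r" for r
    by (simp add: le_fun_def)
  ultimately show ?thesis
    unfolding Pi_order_le_iff[OF alg assms] by metis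
qed

lemma lb_min_lower:
  assumes "f \<in> events T" "g \<in> events T" "F \<in> lb T f g"
  shows "pi_class T (lb_min f g F) \<sqsubseteq>\<^bsub>Pi_order T\<^esub> pi_class T f"
    and "pi_class T (lb_min f g F) \<sqsubseteq>\<^bsub>Pi_order T\<^esub> pi_class T g"
proof -
  obtain f' g' where *: "perspective T f' f" "perspective T g' g" "lb_min f g F = inf f' g'"
    using lb_imp_min_of_representatives[OF assms(3)] .
  then have "lb_min f g F \<le> f'" "lb_min f g F \<le> g'" by simp_all
  with * show "pi_class T (lb_min f g F) \<sqsubseteq>\<^bsub>Pi_order T\<^esub> pi_class T f"
    "pi_class T (lb_min f g F) \<sqsubseteq>\<^bsub>Pi_order T\<^esub> pi_class T g"
    using assms lb_min_events[OF assms(3)] Pi_order_le_iff_representative by blast+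
qed

text \<open>If \<open>k\<close> lies below representatives of both classes, then it lies below their pointwise minimum.\<close>

lemma lower_bound_below_lb_min:
  assumes "k \<in> events T" "f \<in> events T" "g \<in> events T"
    and "pi_class T k \<sqsubseteq>\<^bsub>Pi_order T\<^esub> pi_class T f" "pi_class T k \<sqsubseteq>\<^bsub>Pi_order T\<^esub> pi_class T g"
  obtains F where "F \<in> lb T f g" "pi_class T k \<sqsubseteq>\<^bsub>Pi_order T\<^esub> pi_class T (lb_min f g F)"
proof -
  obtain f' g' where *: "perspective T f' f" "k \<le> f'" "perspective T g' g" "k \<le> g'"
    using assms by (auto simp: Pi_order_le_iff_representative)
  obtain F where F: "F \<in> lb T f g" "lb_min f g F = inf f' g'"
    using min_of_representatives_in_lb[OF *(1,3)] .
  have e: "lb_min f g F \<in> events T" using F(1) by (rule lb_min_events)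
  have "k \<le> lb_min f g F" using * F(2) by simp
  then have "pi_class T k \<sqsubseteq>\<^bsub>Pi_order T\<^esub> pi_class T (lb_min f g F)"
    using Pi_order_le_iff_representative[OF assms(1) e] perspective_refl[OF e] by blast
  with F(1) show thesis by (rule that)
qed

lemma is_glb_Pi_order_iff:
  assumes "f \<in> events T" "g \<in> events T"
  shows "is_glb (Pi_order T) m {pi_class T f, pi_class T g} \<longleftrightarrow>
    m \<in> Pi_classes T \<and> m \<sqsubseteq>\<^bsub>Pi_order T\<^esub> pi_class T f \<and> m \<sqsubseteq>\<^bsub>Pi_order T\<^esub> pi_class T g \<and>
    (\<forall>p\<in>Pi_classes T. p \<sqsubseteq>\<^bsub>Pi_order T\<^esub> pi_class T f \<and> p \<sqsubseteq>\<^bsub>Pi_order T\<^esub> pi_class T g \<longrightarrow>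
      p \<sqsubseteq>\<^bsub>Pi_order T\<^esub> m)"
proof -
  have "carrier (Pi_order T) = Pi_classes T" by (simp add: Pi_order_def)
  moreover have "pi_class T f \<in> Pi_classes T" "pi_class T g \<in> Pi_classes T"
    using assms by (auto simp: Pi_classes_def)
  ultimately show ?thesis by (auto simp: greatest_def Lower_def)
qed

lemma M_condition_imp_glb:
  assumes f: "f \<in> events T" and g: "g \<in> events T" and M: "M_condition T f g F"
  shows "is_glb (Pi_order T) (pi_class T (lb_min f g F)) {pi_class T f, pi_class T g}"
proof -
  interpret partial_order "Pi_order T" by (rule Pi_order_partial_order[OF alg])
  have F: "F \<in> lb T f g"
    using M by (simp add: M_condition_def)
  have greatest: "pi_class T (lb_min f g G) \<sqsubseteq>\<^bsub>Pi_order T\<^esub> pi_class T (lb_min f g F)"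
    if "G \<in> lb T f g" for G
    using M that by (auto simp: M_condition_def)
  have carrier: "pi_class T k \<in> carrier (Pi_order T)" if "k \<in> events T" for k
    using that by (simp add: Pi_order_def Pi_classes_def)
  have "p \<sqsubseteq>\<^bsub>Pi_order T\<^esub> pi_class T (lb_min f g F)"
    if p: "p \<in> Pi_classes T" "p \<sqsubseteq>\<^bsub>Pi_order T\<^esub> pi_class T f" "p \<sqsubseteq>\<^bsub>Pi_order T\<^esub> pi_class T g" for p
  proof -
    obtain k where k: "k \<in> events T" "p = pi_class T k"
      using p(1) by (auto simp: Pi_classes_def)
    obtain G where G: "G \<in> lb T f g" "p \<sqsubseteq>\<^bsub>Pi_order T\<^esub> pi_class T (lb_min f g G)"
      using lower_bound_below_lb_min[OF k(1) f g] p(2,3) k(2) by blast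
    show ?thesis
      using le_trans[OF G(2) greatest[OF G(1)]] carrier k lb_min_events F G(1) by blast
  qed
  moreover have "pi_class T (lb_min f g F) \<in> Pi_classes T"
    using lb_min_events[OF F] by (simp add: Pi_classes_def)
  ultimately show ?thesis
    using lb_min_lower[OF f g F] by (simp add: is_glb_Pi_order_iff[OF f g])
qed

lemma glb_imp_M_condition:
  assumes f: "f \<in> events T" and g: "g \<in> events T"
    and m: "is_glb (Pi_order T) m {pi_class T f, pi_class T g}"
  obtains F where "M_condition T f g F"
proof -
  interpret partial_order "Pi_order T" by (rule Pi_order_partial_order[OF alg])
  note glb = m[unfolded is_glb_Pi_order_iff[OF f g]]
  obtain k where k: "k \<in> events T" "m = pi_class T k"
    using glb by (auto simp: Pi_classes_def)
  obtain F where F: "F \<in> lb T f g" "m \<sqsubseteq>\<^bsub>Pi_order T\<^esub> pi_class T (lb_min f g F)"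
    using lower_bound_below_lb_min[OF k(1) f g] glb k(2) by blast
  have carrier: "pi_class T l \<in> carrier (Pi_order T)" if "l \<in> events T" for l
    using that by (simp add: Pi_order_def Pi_classes_def)
  have "pi_class T (lb_min f g G) \<sqsubseteq>\<^bsub>Pi_order T\<^esub> pi_class T (lb_min f g F)" if G: "G \<in> lb T f g" for G
  proof -
    have "pi_class T (lb_min f g G) \<in> Pi_classes T"
      using lb_min_events[OF G] by (simp add: Pi_classes_def)
    then have "pi_class T (lb_min f g G) \<sqsubseteq>\<^bsub>Pi_order T\<^esub> m"
      using glb lb_min_lower[OF f g G] by blast
    from le_trans[OF this F(2)] show ?thesis
      using carrier k lb_min_events F(1) G by blast
  qed
  with F(1) have "M_condition T f g F" by (simp add: M_condition_def)
  then show thesis by (rule that)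
qed

text \<open>\<^const>\<open>meet\<close> selects some greatest lower bound, so it is determined only because the order is
  antisymmetric.\<close>

lemma meet_Pi_order_eq:
  assumes "is_glb (Pi_order T) m {p, q}"
  shows "p \<sqinter>\<^bsub>Pi_order T\<^esub> q = m"
proof -
  interpret partial_order "Pi_order T" by (rule Pi_order_partial_order[OF alg])
  have "is_glb (Pi_order T) (p \<sqinter>\<^bsub>Pi_order T\<^esub> q) {p, q}"
    unfolding meet_def inf_def using assms by (rule someI)
  then show ?thesis using assms by (rule greatest_unique)
qed

end

theorem theorem2p11:
  fixes T :: "('a \<Rightarrow> nat) set" and f g :: "'a \<Rightarrow> nat"
  assumes "algebraic_E_test_space T"
    and "f \<in> events T" and "g \<in> events T"
  shows "((\<exists>m. is_glb (Pi_order T) m {pi_class T f, pi_class T g}) \<longleftrightarrow>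
      (\<exists>f1\<in>T. \<exists>f2\<in>T. \<exists>f3\<in>T. \<exists>f4\<in>T. M_condition T f g (f1, f2, f3, f4))) \<and>
    (\<forall>f1 f2 f3 f4 h. M_condition T f g (f1, f2, f3, f4) \<and>
      (\<forall>x. int (h x) = min (int (f x) - int (f2 x) + int (f1 x)) (int (g x) - int (f4 x) + int (f3 x))) \<longrightarrow>
      is_glb (Pi_order T) (pi_class T h) {pi_class T f, pi_class T g} \<and>
      pi_class T f \<sqinter>\<^bsub>Pi_order T\<^esub> pi_class T g = pi_class T h)"
proof (intro conjI allI impI)
  show "(\<exists>m. is_glb (Pi_order T) m {pi_class T f, pi_class T g}) \<longleftrightarrow>
      (\<exists>f1\<in>T. \<exists>f2\<in>T. \<exists>f3\<in>T. \<exists>f4\<in>T. M_condition T f g (f1, f2, f3, f4))"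
  proof
    assume "\<exists>m. is_glb (Pi_order T) m {pi_class T f, pi_class T g}"
    then obtain F where F: "M_condition T f g F"
      using glb_imp_M_condition[OF assms] by blast
    obtain f1 f2 f3 f4 where "F = (f1, f2, f3, f4)" by (cases F)
    with F show "\<exists>f1\<in>T. \<exists>f2\<in>T. \<exists>f3\<in>T. \<exists>f4\<in>T. M_condition T f g (f1, f2, f3, f4)"
      by (auto simp: M_condition_def lb_def)
  next
    assume "\<exists>f1\<in>T. \<exists>f2\<in>T. \<exists>f3\<in>T. \<exists>f4\<in>T. M_condition T f g (f1, f2, f3, f4)"
    then show "\<exists>m. is_glb (Pi_order T) m {pi_class T f, pi_class T g}"
      using M_condition_imp_glb[OF assms] by blast
  qed
  fix f1 f2 f3 f4 h
  assume h: "M_condition T f g (f1, f2, f3, f4) \<and>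
      (\<forall>x. int (h x) = min (int (f x) - int (f2 x) + int (f1 x)) (int (g x) - int (f4 x) + int (f3 x)))"
  then have "(f1, f2, f3, f4) \<in> lb T f g" by (simp add: M_condition_def)
  then have "int (h x) = int (lb_min f g (f1, f2, f3, f4) x)" for x
    using h by (simp only: lb_min_int)
  then have "h = lb_min f g (f1, f2, f3, f4)" by (simp add: fun_eq_iff)
  then show glb: "is_glb (Pi_order T) (pi_class T h) {pi_class T f, pi_class T g}"
    using M_condition_imp_glb[OF assms] h by simp
  show "pi_class T f \<sqinter>\<^bsub>Pi_order T\<^esub> pi_class T g = pi_class T h"
    using assms(1) glb by (rule meet_Pi_order_eq)
qed

end
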